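(* Let $R>0$, and assume the true score sequence $r_1^*,r_2^*,\ldots\in[0,R]$ is drawn i.i.d. from an unknown distribution $\mathcal{D}$. Run the regularized-belief algorithm with step sizes $\lambda_t=1/\sqrt{t}$ and an arbitrary prior $P_0$ on $[0,R]$ (with strictly positive density). Then for any fixed $t\ge 2$ and $\delta\in(0,1)$, with probability at least $1-\delta$ over the randomness of $r^*_{1:t-1}$, we have for all $\alpha\in[0,1]$, $$\mathbb{E}_{r_t^*\sim\mathcal{D}}[l_\alpha(r_t(\alpha),r_t^* )]\le\min_{r\in[0,R]}\mathbb{E}_{r_t^*\sim\mathcal{D}}[l_\alpha(r,r_t^* )]+O\left(R\sqrt{\frac{\log(1/\delta)}{t}}\right).$$
   Context: Quantile loss: $l_\alpha(r,r^* )=(\mathbf{1}[r\ge r^*]-\alpha)(r-r^* )$. $\log$ is the natural logarithm. Quantile: the $\alpha$-quantile of a real random variable $X$ (or of its distribution) is $q_\alpha(X)=\min\{x:\mathbb{P}(X\le x)\ge\alpha\}$. $\bar P(r^*_{1:n})$ denotes the empirical distribution of $r_1^*,\ldots,r_n^*$. Regularized-belief algorithm: given a prior $P_0$ on $[0,R]$ with strictly positive density and step sizes $(\lambda_t)$ with $\lambda_1=1$ and $\lambda_t\in(0,1)$ for $t\ge2$, in round $t$ it forms $P_t=\lambda_tP_0+(1-\lambda_t)\bar P(r^*_{1:t-1})$ (so $P_1=P_0$), outputs $r_t(\alpha)=q_\alpha(P_t)$ for each queried $\alpha\in[0,1]$, and then observes $r_t^*\in[0,R]$. Thus $r_t(\alpha)$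 is determined by $r^*_{1:t-1}$ and $\alpha$, and the expectation over $r_t^*$ is taken with $r^*_{1:t-1}$ fixed.
   Formalization: The constant in O(·) is uniform only for δ bounded away from 1: for each η<1 one constant serves all δ≤η and all R, D, P_0, t, α; a single constant for all δ in (0,1) fails, e.g. D a point mass at 0, uniform prior, t=2, α=1/2, δ→1. The 0-quantile is taken to be 0. *)

theory Defs
  imports "HOL-Probability.Probability"
begin

definition quantile_loss :: "real \<Rightarrow> real \<Rightarrow> real \<Rightarrow> real" where
  "quantile_loss \<alpha> r s = (of_bool (r \<ge> s) - \<alpha>) * (r - s)"

text \<open>The minimum is taken over the outcome range \<open>{0..R}\<close>. For \<open>\<alpha> > 0\<close> and a distribution \<open>P\<close>
  carried by \<open>{0..R}\<close> this is the minimum over all reals; for \<open>\<alpha> = 0\<close>, where the minimum over all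
  reals does not exist, it yields \<open>0\<close>.\<close>

definition quantile :: "real \<Rightarrow> real measure \<Rightarrow> real \<Rightarrow> real" where
  "quantile R P \<alpha> = (LEAST x. x \<in> {0..R} \<and> measure P {..x} \<ge> \<alpha>)"

definition distribution_on :: "real \<Rightarrow> real measure \<Rightarrow> bool" where
  "distribution_on R D \<longleftrightarrow> prob_space D \<and> sets D = sets borel \<and> measure D {0..R} = 1"

definition positive_density_prior :: "real \<Rightarrow> real measure \<Rightarrow> bool" where
  "positive_density_prior R P \<longleftrightarrow> prob_space P \<and>
     (\<exists>f :: real \<Rightarrow> real. f \<in> borel_measurable borel \<and> (\<forall>x\<in>{0..R}. 0 < f x) \<and>
        P = density lborel (\<lambda>x. ennreal (f x) * indicator {0..R} x))"

text \<open>The law of \<open>r J\<close> for an index \<open>J\<close> uniform on \<open>{1..n}\<close>, so that repeated values among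
  \<open>r 1, \<dots>, r n\<close> are counted with multiplicity.\<close>

definition empirical :: "(nat \<Rightarrow> real) \<Rightarrow> nat \<Rightarrow> real pmf" where
  "empirical r n = map_pmf r (pmf_of_set {1..n})"

definition mixture :: "real \<Rightarrow> real measure \<Rightarrow> real measure \<Rightarrow> real measure" where
  "mixture c P Q = measure_of UNIV (sets borel)
     (\<lambda>A. ennreal c * emeasure P A + ennreal (1 - c) * emeasure Q A)"

text \<open>If \<open>lam 1 = 1\<close>, then the belief at time \<open>1\<close> is the prior \<open>P0\<close>: the (unspecified) empirical
  distribution of the empty sample gets weight \<open>0\<close>.\<close>

definition belief :: "real measure \<Rightarrow> (nat \<Rightarrow> real) \<Rightarrow> (nat \<Rightarrow> real) \<Rightarrow> nat \<Rightarrow> real measure" where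
  "belief P0 lam r t = mixture (lam t) P0 (measure_pmf (empirical r (t - 1)))"

definition forecast ::
    "real \<Rightarrow> real measure \<Rightarrow> (nat \<Rightarrow> real) \<Rightarrow> (nat \<Rightarrow> real) \<Rightarrow> nat \<Rightarrow> real \<Rightarrow> real" where
  "forecast R P0 lam r t \<alpha> = quantile R (belief P0 lam r t) \<alpha>"

definition expected_loss :: "real measure \<Rightarrow> real \<Rightarrow> real \<Rightarrow> real" where
  "expected_loss D \<alpha> r = (\<integral>s. quantile_loss \<alpha> r s \<partial>D)"

lemma emeasure_mixture:
  assumes "sets P = sets borel" "sets borel \<subseteq> sets Q" "A \<in> sets borel"
  shows "emeasure (mixture c P Q) A = ennreal c * emeasure P A + ennreal (1 - c) * emeasure Q A"
proof (rule emeasure_measure_of[OF mixture_def])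
  show "countably_additive (sets (mixture c P Q))
          (\<lambda>A. ennreal c * emeasure P A + ennreal (1 - c) * emeasure Q A)"
  proof (rule countably_additiveI)
    fix B :: "nat \<Rightarrow> real set"
    assume B: "range B \<subseteq> sets (mixture c P Q)" "disjoint_family B"
    have "sets (mixture c P Q) = sets borel"
      unfolding mixture_def by (metis sets.sigma_sets_eq sets_measure_of space_borel subset_UNIV Pow_UNIV top_greatest)
    with B(1) assms have BP: "range B \<subseteq> sets P" and BQ: "range B \<subseteq> sets Q" by auto
    show "(\<Sum>i. ennreal c * emeasure P (B i) + ennreal (1 - c) * emeasure Q (B i)) =
        ennreal c * emeasure P (\<Union>i. B i) + ennreal (1 - c) * emeasure Q (\<Union>i. B i)"
      by (simp add: suminf_add[symmetric] suminf_emeasure[OF BP B(2)] suminf_emeasure[OF BQ B(2)])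
  qed
  show "A \<in> sets (mixture c P Q)"
    unfolding mixture_def using assms(3)
    by (metis sets.sigma_sets_eq sets_measure_of space_borel subset_UNIV Pow_UNIV top_greatest)
qed (auto simp: positive_def)

end

theory Submission
  imports Defs
begin

text \<open>The excess loss of \<open>q\<close> over \<open>s\<close> is the integral of \<open>F - \<alpha>\<close> from \<open>s\<close> to \<open>q\<close>, where \<open>F\<close> is
  the distribution function of \<open>D\<close>. If \<open>q\<close> is the \<open>\<alpha>\<close>-quantile of the belief, with distribution
  function \<open>G\<close>, then \<open>G < \<alpha>\<close> below \<open>q\<close> and \<open>G \<ge> \<alpha>\<close> from \<open>q\<close> on, so the excess loss is at most the
  integral of \<open>\<bar>F - G\<bar>\<close> over \<open>[0, R]\<close>, simultaneously for all \<open>\<alpha>\<close>. Mixing in the prior contributes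
  at most \<open>R / sqrt t\<close> to it. What remains is the average over \<open>x\<close> of the deviation of the empirical
  distribution function at \<open>x\<close>; since only this average matters, no uniform (DKW) bound is needed:
  by Jensen and Fubini the moment generating function of the average is bounded by the pointwise
  ones, for which Hoeffding's lemma applies.\<close>

section \<open>Quantiles\<close>

text \<open>Right continuity of the distribution function makes the infimum of the admissible points
  admissible itself; \<open>R\<close> witnesses that there are some.\<close>

lemma (in real_distribution)
  assumes "0 \<le> R" "\<alpha> \<le> cdf M R"
  shows quantile_in: "quantile R M \<alpha> \<in> {0..R}"
    and cdf_quantile_ge: "\<alpha> \<le> cdf M (quantile R M \<alpha>)"
    and quantile_least: "\<And>x. x \<in> {0..R} \<Longrightarrow> \<alpha> \<le> cdf M x \<Longrightarrow> quantile R M \<alpha> \<le> x"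
proof -
  define S where "S = {x \<in> {0..R}. \<alpha> \<le> cdf M x}"
  define m where "m = Inf S"
  have S: "R \<in> S" "bdd_below S" using assms by (auto simp: S_def bdd_below_def)
  have m: "m \<in> {0..R}"
    using S unfolding m_def by (auto intro!: cInf_greatest cInf_lower simp: S_def)
  have lower: "m \<le> x" if "x \<in> {0..R}" "\<alpha> \<le> cdf M x" for x
    unfolding m_def using that S by (intro cInf_lower) (auto simp: S_def)
  have "\<alpha> \<le> cdf M x" if x: "m < x" for x
  proof -
    obtain s where "s \<in> S" "s < x"
      using x S cInf_lessD[of S x] by (auto simp: m_def)
    then show ?thesis using cdf_nondecreasing[of s x] by (auto simp: S_def)
  qed
  then have "\<alpha> \<le> cdf M m"
    using cdf_is_right_cont[of m] unfolding continuous_within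
    by (intro tendsto_lowerbound[where F="at_right m"])
       (auto simp: eventually_at_right_less intro!: eventually_at_rightI[of m "m + 1"])
  moreover from this have "quantile R M \<alpha> = m"
    unfolding quantile_def using m lower by (intro Least_equality) (auto simp: cdf_def)
  ultimately show "quantile R M \<alpha> \<in> {0..R}" "\<alpha> \<le> cdf M (quantile R M \<alpha>)"
      "\<And>x. x \<in> {0..R} \<Longrightarrow> \<alpha> \<le> cdf M x \<Longrightarrow> quantile R M \<alpha> \<le> x"
    using m lower by auto
qed

text \<open>If no point of the range reaches the level, \<open>LEAST\<close> returns an unspecified
  real, but the same one for every such measure and level. Measurability and left continuity of the
  quantile therefore extend to this case.\<close>

lemma (in real_distribution) quantile_undefined:
  assumes "cdf M R < \<alpha>"
  shows "quantile R M \<alpha> = (LEAST x. False)"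
proof -
  have "(\<lambda>x. x \<in> {0..R} \<and> \<alpha> \<le> measure M {..x}) = (\<lambda>x. False)"
    using assms cdf_nondecreasing[of _ R] by (force simp: cdf_def)
  then show ?thesis by (simp add: quantile_def)
qed

text \<open>Reduces sublevel sets of the quantile to the distribution function at the fixed points
  \<open>R\<close> and \<open>min a R\<close>, the form in which measurability for a random measure
  can be read off.\<close>

lemma (in real_distribution) quantile_le_iff:
  assumes "0 \<le> R"
  shows "quantile R M \<alpha> \<le> a \<longleftrightarrow>
    (if \<alpha> \<le> cdf M R then 0 \<le> a \<and> \<alpha> \<le> cdf M (min a R) else (LEAST x. False) \<le> a)"
proof (cases "\<alpha> \<le> cdf M R")
  case True
  note q = quantile_in[OF assms True] cdf_quantile_ge[OF assms True]
  show ?thesis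
  proof (intro iffI)
    assume "quantile R M \<alpha> \<le> a"
    with q cdf_nondecreasing[of "quantile R M \<alpha>" "min a R"] True
    show "if \<alpha> \<le> cdf M R then 0 \<le> a \<and> \<alpha> \<le> cdf M (min a R) else (LEAST x. False) \<le> a"
      by auto
  next
    assume "if \<alpha> \<le> cdf M R then 0 \<le> a \<and> \<alpha> \<le> cdf M (min a R) else (LEAST x. False) \<le> a"
    with True quantile_least[OF assms True, of "min a R"] assms show "quantile R M \<alpha> \<le> a" by auto
  qed
qed (simp add: quantile_undefined)

lemma borel_measurable_quantile:
  assumes "0 \<le> R" "\<And>\<omega>. \<omega> \<in> space N \<Longrightarrow> real_distribution (K \<omega>)"
    and [measurable]: "\<And>x. (\<lambda>\<omega>. cdf (K \<omega>) x) \<in> borel_measurable N"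
  shows "(\<lambda>\<omega>. quantile R (K \<omega>) \<alpha>) \<in> borel_measurable N"
  unfolding borel_measurable_iff_le
proof
  fix a
  have "{\<omega> \<in> space N. quantile R (K \<omega>) \<alpha> \<le> a} =
      {\<omega> \<in> space N. if \<alpha> \<le> cdf (K \<omega>) R then 0 \<le> a \<and> \<alpha> \<le> cdf (K \<omega>) (min a R)
         else (LEAST x. False) \<le> a}"
    using real_distribution.quantile_le_iff[OF assms(2) assms(1)] by auto
  also have "\<dots> \<in> sets N" by measurable
  finally show "{\<omega> \<in> space N. quantile R (K \<omega>) \<alpha> \<le> a} \<in> sets N" .
qed

text \<open>Any \<open>a\<close> in the range below the quantile at \<open>\<alpha>\<close> has
  \<open>cdf M a < \<alpha>\<close>, and levels between these two have their quantile beyond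
  \<open>a\<close>. From the right the quantile may jump, at flat pieces of the distribution
  function.\<close>

lemma (in real_distribution) tendsto_quantile_at_left:
  assumes "0 \<le> R"
  shows "((\<lambda>\<beta>. quantile R M \<beta>) \<longlongrightarrow> quantile R M \<alpha>) (at_left \<alpha>)"
proof (cases "\<alpha> \<le> cdf M R")
  case True
  have less: "eventually (\<lambda>\<beta>. \<beta> < \<alpha>) (at_left \<alpha>)"
    by (simp add: eventually_at_filter)
  show ?thesis
  proof (rule order_tendstoI)
    fix a assume a: "a < quantile R M \<alpha>"
    show "eventually (\<lambda>\<beta>. a < quantile R M \<beta>) (at_left \<alpha>)"
    \<comment> \<open>\<open>M\<close> may have mass below 0, so \<open>cdf M a\<close> says nothing
      for negative \<open>a\<close>; there \<open>quantile_in\<close> suffices.\<close>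
    proof (cases "a < 0")
      case True
      show ?thesis using less
      proof eventually_elim
        case (elim \<beta>)
        then show ?case using quantile_in[OF assms, of \<beta>] \<open>\<alpha> \<le> cdf M R\<close> True by auto
      qed
    next
      case False
      have "cdf M a < \<alpha>"
        using a False quantile_in[OF assms True] quantile_least[OF assms True, of a] by force
      then have "eventually (\<lambda>\<beta>. cdf M a < \<beta>) (at_left \<alpha>)"
        by (rule eventually_at_leftI[rotated]) auto
      with less show ?thesis
      proof eventually_elim
        case (elim \<beta>)
        then show ?case
          using cdf_quantile_ge[OF assms, of \<beta>] cdf_nondecreasing[of "quantile R M \<beta>" a] True by force
      qed
    qed
  next
    fix a assume "quantile R M \<alpha> < a"
    show "eventually (\<lambda>\<beta>. quantile R M \<beta> < a) (at_left \<alpha>)" using less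
    proof eventually_elim
      case (elim \<beta>)
      then show ?case
        using \<open>quantile R M \<alpha> < a\<close> quantile_least[OF assms, of \<beta> "quantile R M \<alpha>"] quantile_in[OF assms True]
          cdf_quantile_ge[OF assms True] True by force
    qed
  qed
next
  case False
  then have "eventually (\<lambda>\<beta>. cdf M R < \<beta>) (at_left \<alpha>)"
    by (intro eventually_at_leftI[of "cdf M R"]) auto
  then have "eventually (\<lambda>\<beta>. quantile R M \<beta> = quantile R M \<alpha>) (at_left \<alpha>)"
    by eventually_elim (use False in \<open>simp add: quantile_undefined\<close>)
  then show ?thesis by (rule tendsto_eventually)
qed

section \<open>The expected loss\<close>

lemma quantile_loss_eq: "quantile_loss \<alpha> r s = max (r - s) 0 - \<alpha> * (r - s)"
  by (simp add: quantile_loss_def max_def algebra_simps)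

lemma distribution_on_imp_real_distribution:
  "distribution_on R D \<Longrightarrow> real_distribution D"
  by (simp add: distribution_on_def real_distribution_def real_distribution_axioms_def)

locale bounded_distribution =
  fixes R :: real and D :: "real measure"
  assumes pos: "0 < R" and dist: "distribution_on R D"
begin

sublocale D: real_distribution D
  using dist by (rule distribution_on_imp_real_distribution)

lemma AE_in: "AE s in D. s \<in> {0..R}"
proof -
  have "D.prob {0..R} = 1" using dist by (simp add: distribution_on_def)
  then show ?thesis by (rule D.AE_prob_1)
qed

lemma integrable_id: "integrable D (\<lambda>s. s)"
  by (rule D.integrable_const_bound[of _ R], rule eventually_mono[OF AE_in]) auto

text \<open>This is the integral of the distribution function of \<open>D\<close> up to
  \<open>r\<close>: the part of the expected loss that is free of \<open>\<alpha>\<close>.\<close>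

definition upper_mean :: "real \<Rightarrow> real" where
  "upper_mean r = (\<integral>s. max (r - s) 0 \<partial>D)"

lemma integrable_max: "integrable D (\<lambda>s. max (r - s) 0)"
  by (rule D.integrable_const_bound[of _ "\<bar>r\<bar> + R"], rule eventually_mono[OF AE_in]) auto

lemma expected_loss_eq: "expected_loss D \<alpha> r = upper_mean r - \<alpha> * (r - (\<integral>s. s \<partial>D))"
  unfolding expected_loss_def quantile_loss_eq upper_mean_def
  using integrable_id integrable_max D.prob_space by (simp add: right_diff_distrib)

lemma expected_loss_nonneg:
  assumes "\<alpha> \<in> {0..1}"
  shows "0 \<le> expected_loss D \<alpha> r"
  unfolding expected_loss_def
proof (rule Bochner_Integration.integral_nonneg)
  fix s show "0 \<le> quantile_loss \<alpha> r s"
    using assms by (cases "s \<le> r")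
      (auto simp: quantile_loss_def mult_nonneg_nonneg intro: mult_nonneg_nonpos)
qed

text \<open>The integrand is 1-Lipschitz in \<open>r\<close> for each \<open>s\<close>. The
  resulting continuity later allows the passage to the limit from rational levels.\<close>

lemma abs_upper_mean_diff_le: "\<bar>upper_mean a - upper_mean b\<bar> \<le> \<bar>a - b\<bar>"
proof -
  have "upper_mean a - upper_mean b = (\<integral>s. max (a - s) 0 - max (b - s) 0 \<partial>D)"
    unfolding upper_mean_def
    by (intro Bochner_Integration.integral_diff[symmetric] integrable_max)
  also have "\<bar>\<dots>\<bar> \<le> (\<integral>s. \<bar>max (a - s) 0 - max (b - s) 0\<bar> \<partial>D)"
    by (rule integral_abs_bound)
  also have "\<dots> \<le> (\<integral>s. \<bar>a - b\<bar> \<partial>D)"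
    by (intro Bochner_Integration.integral_mono integrable_abs Bochner_Integration.integrable_diff
          integrable_max) auto
  finally show ?thesis using D.prob_space by simp
qed

lemma continuous_upper_mean: "continuous_on UNIV upper_mean"
  unfolding continuous_on_iff dist_real_def
  using abs_upper_mean_diff_le by (meson le_less_trans)

text \<open>Integrals over \<open>{0..R}\<close> are written as \<open>R\<close> times an average
  under \<open>U\<close>, since Jensen's inequality asks for a probability measure.\<close>

abbreviation U :: "real measure" where
  "U \<equiv> uniform_measure lborel {0..R}"

sublocale U: prob_space U
  by (rule prob_space_uniform_measure) (use pos in auto)

sublocale UD: pair_prob_space U D ..

lemma measure_U_atLeastLessThan:
  assumes "0 \<le> a" "b \<le> R"
  shows "measure U {a..<b} = max 0 (b - a) / R"
proof -
  have "{0..R} \<inter> {a..<b} = {a..<b}" using assms by auto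
  then show ?thesis using pos by (subst measure_uniform_measure) (auto simp: max_def)
qed

lemma cdf_measurable [measurable]: "cdf D \<in> borel_measurable borel"
  by (rule borel_measurable_mono) (auto intro!: monoI D.cdf_nondecreasing)

text \<open>Fubini on the region \<open>a \<le> x < b\<close>, \<open>s \<le> x\<close>: integrating
  over \<open>s\<close> first gives the distribution function, integrating over \<open>x\<close>
  first gives the difference of positive parts.\<close>

lemma upper_mean_diff:
  assumes "0 \<le> a" "a \<le> b" "b \<le> R"
  shows "upper_mean b - upper_mean a = R * (\<integral>x. indicator {a..<b} x * cdf D x \<partial>U)"
proof -
  define f :: "real \<Rightarrow> real \<Rightarrow> real" where "f x s = of_bool (a \<le> x \<and> x < b \<and> s \<le> x)" for x s
  have f: "f x s = indicator {a..<b} x * indicator {..x} s"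
       "f x s = indicator {max a s..<b} x" for x s
    by (auto simp: f_def indicator_def)
  have int: "integrable (U \<Otimes>\<^sub>M D) (case_prod f)"
  proof (rule UD.integrable_const_bound[of _ 1])
    show "case_prod f \<in> borel_measurable (U \<Otimes>\<^sub>M D)"
      unfolding f_def by measurable
  qed (auto simp: f_def)
  have "(\<integral>x. indicator {a..<b} x * cdf D x \<partial>U) = (\<integral>x. (\<integral>s. f x s \<partial>D) \<partial>U)"
    by (simp add: f(1) cdf_def)
  also have "\<dots> = (\<integral>s. (\<integral>x. f x s \<partial>U) \<partial>D)"
    using UD.Fubini_integral[OF int] by simp
  also have "\<dots> = (\<integral>s. max 0 (b - max a s) / R \<partial>D)"
    unfolding f(2) using measure_U_atLeastLessThan[of "max a _" b] assms by simp
  also have "R * \<dots> = (\<integral>s. max 0 (b - max a s) \<partial>D)"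
    using pos by simp
  also have "\<dots> = (\<integral>s. max (b - s) 0 - max (a - s) 0 \<partial>D)"
    using assms by (intro Bochner_Integration.integral_cong) (auto simp: max_def)
  also have "\<dots> = upper_mean b - upper_mean a"
    unfolding upper_mean_def by (intro Bochner_Integration.integral_diff integrable_max)
  finally show ?thesis by simp
qed

lemma integrable_U_bounded:
  fixes g :: "real \<Rightarrow> real"
  assumes "g \<in> borel_measurable borel" "\<And>x. \<bar>g x\<bar> \<le> B"
  shows "integrable U g"
  by (rule U.integrable_const_bound[of _ B]) (use assms in auto)

lemma expected_loss_diff:
  assumes "0 \<le> a" "a \<le> b" "b \<le> R"
  shows "expected_loss D \<alpha> b - expected_loss D \<alpha> a
           = R * (\<integral>x. indicator {a..<b} x * (cdf D x - \<alpha>) \<partial>U)"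
proof -
  have "(\<integral>x. indicator {a..<b} x * (cdf D x - \<alpha>) \<partial>U)
      = (\<integral>x. indicator {a..<b} x * cdf D x - \<alpha> * indicator {a..<b} x \<partial>U)"
    by (simp add: algebra_simps)
  also have "\<dots> = (\<integral>x. indicator {a..<b} x * cdf D x \<partial>U) - (\<integral>x. \<alpha> * indicator {a..<b} x \<partial>U)"
    by (intro Bochner_Integration.integral_diff integrable_U_bounded[where B = 1]
          integrable_U_bounded[where B = "\<bar>\<alpha>\<bar>"])
       (auto simp: indicator_def D.cdf_nonneg D.cdf_bounded_prob)
  also have "(\<integral>x. \<alpha> * indicator {a..<b} x \<partial>U) = \<alpha> * ((b - a) / R)"
    using measure_U_atLeastLessThan[of a b] assms by simp
  finally show ?thesis
    using pos upper_mean_diff[OF assms] by (simp add: expected_loss_eq field_simps)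
qed

text \<open>The bound is deterministic and its error term is free of \<open>\<alpha>\<close>, which
  is why a single event will serve all levels at once.\<close>

lemma excess_loss_le:
  assumes "real_distribution K" "\<alpha> \<le> cdf K R" "s \<in> {0..R}"
  shows "expected_loss D \<alpha> (quantile R K \<alpha>)
           \<le> expected_loss D \<alpha> s + R * (\<integral>x. \<bar>cdf D x - cdf K x\<bar> \<partial>U)"
proof -
  interpret K: real_distribution K by fact
  have R: "0 \<le> R" using pos by simp
  define q where "q = quantile R K \<alpha>"
  have q: "q \<in> {0..R}" "\<alpha> \<le> cdf K q" "\<And>x. x \<in> {0..R} \<Longrightarrow> \<alpha> \<le> cdf K x \<Longrightarrow> q \<le> x"
    unfolding q_def using K.quantile_in[OF R assms(2)] K.cdf_quantile_ge[OF R assms(2)]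
      K.quantile_least[OF R assms(2)] by auto
  have [measurable]: "cdf K \<in> borel_measurable borel"
    by (rule borel_measurable_mono) (auto intro!: monoI K.cdf_nondecreasing)
  have bounds: "0 \<le> cdf D x" "cdf D x \<le> 1" "0 \<le> cdf K x" "cdf K x \<le> 1" for x
    by (simp_all add: D.cdf_nonneg D.cdf_bounded_prob K.cdf_nonneg K.cdf_bounded_prob)
  have int: "integrable U (\<lambda>x. \<bar>cdf D x - cdf K x\<bar>)"
  proof (rule integrable_U_bounded[of _ 1])
    show "\<bar>\<bar>cdf D x - cdf K x\<bar>\<bar> \<le> 1" for x using bounds[of x] by linarith
  qed measurable
  have int': "integrable U (\<lambda>x. indicator {a..<b} x * (cdf D x - \<alpha>))" for a b :: real
  proof (rule integrable_U_bounded[of _ "1 + \<bar>\<alpha>\<bar>"])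
    show "\<bar>indicator {a..<b} x * (cdf D x - \<alpha>)\<bar> \<le> 1 + \<bar>\<alpha>\<bar>" for x
      using bounds[of x] by (auto simp: indicator_def)
  qed measurable
  show ?thesis
  proof (cases "s \<le> q")
    case True
    have "expected_loss D \<alpha> q - expected_loss D \<alpha> s
        = R * (\<integral>x. indicator {s..<q} x * (cdf D x - \<alpha>) \<partial>U)"
      using q True assms by (intro expected_loss_diff) auto
    also have "\<dots> \<le> R * (\<integral>x. \<bar>cdf D x - cdf K x\<bar> \<partial>U)"
    proof (intro mult_left_mono Bochner_Integration.integral_mono int int')
      \<comment> \<open>Minimality of \<open>q\<close> concerns only points of
        \<open>{0..R}\<close>; here \<open>0 \<le> s \<le> x < q \<le> R\<close>, so it yields
        \<open>cdf K x < \<alpha>\<close>.\<close>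
      fix x show "indicator {s..<q} x * (cdf D x - \<alpha>) \<le> \<bar>cdf D x - cdf K x\<bar>"
        using q(1) q(3)[of x] assms(3) by (cases "x \<in> {s..<q}") force+
    qed (use R in auto)
    finally show ?thesis by (simp add: q_def)
  next
    case False
    have "expected_loss D \<alpha> q - expected_loss D \<alpha> s
        = R * (\<integral>x. - (indicator {q..<s} x * (cdf D x - \<alpha>)) \<partial>U)"
      using expected_loss_diff[of q s \<alpha>] q False assms by simp
    also have "\<dots> \<le> R * (\<integral>x. \<bar>cdf D x - cdf K x\<bar> \<partial>U)"
    proof (intro mult_left_mono Bochner_Integration.integral_mono int integrable_minus int')
      fix x show "- (indicator {q..<s} x * (cdf D x - \<alpha>)) \<le> \<bar>cdf D x - cdf K x\<bar>"
        using q(2) K.cdf_nondecreasing[of q x] by (cases "x \<in> {q..<s}") auto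
    qed (use R in auto)
    finally show ?thesis by (simp add: q_def)
  qed
qed

end

section \<open>Concentration of the empirical distribution function\<close>

text \<open>The distribution function of \<open>empirical r n\<close> for \<open>n \<ge> 1\<close>,
  written as a normalized sum so that independence of the terms can be exploited.\<close>

definition ecdf :: "(nat \<Rightarrow> real) \<Rightarrow> nat \<Rightarrow> real \<Rightarrow> real" where
  "ecdf r n x = (\<Sum>i\<in>{1..n}. of_bool (r i \<le> x)) / real n"

lemma ecdf_nonneg: "0 \<le> ecdf r n x"
  by (simp add: ecdf_def sum_nonneg)

lemma ecdf_le_1: "ecdf r n x \<le> 1"
proof (cases "n = 0")
  case False
  have "(\<Sum>i\<in>{1..n}. of_bool (r i \<le> x) :: real) \<le> (\<Sum>i\<in>{1..n}. 1)"
    by (intro sum_mono) auto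
  with False show ?thesis by (simp add: ecdf_def)
qed (simp add: ecdf_def)

lemma cdf_empirical:
  assumes "n \<ge> 1"
  shows "cdf (measure_pmf (empirical r n)) x = ecdf r n x"
proof -
  have "cdf (measure_pmf (empirical r n)) x = card ({1..n} \<inter> r -` {..x}) / card {1..n}"
    unfolding cdf_def empirical_def using assms by (simp add: measure_pmf_of_set)
  also have "real (card ({1..n} \<inter> r -` {..x})) = (\<Sum>i\<in>{1..n}. of_bool (r i \<le> x))"
    by (simp add: of_bool_def sum.If_cases) (simp add: Int_def vimage_def)
  finally show ?thesis by (simp add: ecdf_def)
qed

text \<open>Independence splits the exponential of the mean into \<open>n\<close> equal factors.
  Hoeffding's lemma with parameter \<open>l / n\<close> bounds each of them, and the
  \<open>n\<close> exponents add up.\<close>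

lemma (in prob_space) nn_integral_exp_mean_le:
  assumes [measurable]: "g \<in> borel_measurable M"
    and bounds: "\<And>x. g x \<in> {a..b}" and mean: "expectation g = 0" and "0 < l" "1 \<le> n"
  shows "(\<integral>\<^sup>+r. ennreal (exp (l * ((\<Sum>i\<in>{1..n}. g (r i)) / real n))) \<partial>Pi\<^sub>M {1..n} (\<lambda>_. M))
           \<le> ennreal (exp (l\<^sup>2 * (b - a)\<^sup>2 / (8 * real n)))"
proof -
  interpret product_sigma_finite "\<lambda>_::nat. M" ..
  interpret g: interval_bounded_random_variable M g a b
    by unfold_locales (use bounds in auto)
  define k where "k = l / real n"
  have k: "0 < k" using assms by (simp add: k_def)
  have "(\<integral>\<^sup>+r. ennreal (exp (l * ((\<Sum>i\<in>{1..n}. g (r i)) / real n))) \<partial>Pi\<^sub>M {1..n} (\<lambda>_. M))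
      = (\<integral>\<^sup>+r. (\<Prod>i\<in>{1..n}. ennreal (exp (k * g (r i)))) \<partial>Pi\<^sub>M {1..n} (\<lambda>_. M))"
    by (simp add: k_def prod_ennreal exp_sum[symmetric] sum_distrib_left sum_divide_distrib)
  also have "\<dots> = (\<Prod>i\<in>{1..n}. \<integral>\<^sup>+x. ennreal (exp (k * g x)) \<partial>M)"
    by (intro product_nn_integral_prod) auto
  also have "\<dots> \<le> (\<Prod>i\<in>{1..n}. ennreal (exp (k\<^sup>2 * (b - a)\<^sup>2 / 8)))"
    by (intro prod_mono_ennreal) (use g.Hoeffdings_lemma_nn_integral_0[OF k mean] in auto)
  also have "\<dots> = ennreal (exp (real n * (k\<^sup>2 * (b - a)\<^sup>2 / 8)))"
    by (simp only: exp_of_nat_mult) (simp add: ennreal_power)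
  also have "real n * (k\<^sup>2 * (b - a)\<^sup>2 / 8) = l\<^sup>2 * (b - a)\<^sup>2 / (8 * real n)"
    using assms by (simp add: k_def power2_eq_square field_simps)
  finally show ?thesis .
qed

text \<open>The absolute value is removed by bounding its exponential by the sum of the exponentials
  for both signs, whence the factor 2.\<close>

lemma (in real_distribution) nn_integral_exp_abs_cdf_diff_ecdf_le:
  assumes "0 < l" "1 \<le> n"
  shows "(\<integral>\<^sup>+r. ennreal (exp (l * \<bar>cdf M x - ecdf r n x\<bar>)) \<partial>Pi\<^sub>M {1..n} (\<lambda>_. M))
           \<le> ennreal (2 * exp (l\<^sup>2 / (8 * real n)))"
proof -
  define g :: "real \<Rightarrow> real" where "g s = of_bool (s \<le> x) - cdf M x" for s
  have [measurable]: "g \<in> borel_measurable M" unfolding g_def by measurable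
  have bounds: "0 \<le> cdf M x" "cdf M x \<le> 1"
    by (simp_all add: cdf_nonneg cdf_bounded_prob)
  have g: "g = (\<lambda>s. indicator {..x} s - cdf M x)"
    by (auto simp: g_def indicator_def)
  have "expectation g = expectation (indicator {..x}) - expectation (\<lambda>_. cdf M x)"
    unfolding g by (intro Bochner_Integration.integral_diff integrable_real_indicator)
      (auto simp: emeasure_eq_measure)
  then have mean: "expectation g = 0"
    using prob_space by (simp add: cdf_def)
  \<comment> \<open>Both intervals have length 1, so each sign contributes the same
    exponent.\<close>
  have range: "g s \<in> {- cdf M x..1 - cdf M x}" "- g s \<in> {cdf M x - 1..cdf M x}" for s
    using bounds by (auto simp: g_def)
  have sum: "(\<Sum>i\<in>{1..n}. g (r i)) / real n = ecdf r n x - cdf M x" for r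
    using assms by (simp add: g_def ecdf_def sum_subtractf field_simps)
  have "(\<integral>\<^sup>+r. ennreal (exp (l * \<bar>cdf M x - ecdf r n x\<bar>)) \<partial>Pi\<^sub>M {1..n} (\<lambda>_. M))
      \<le> (\<integral>\<^sup>+r. ennreal (exp (l * ((\<Sum>i\<in>{1..n}. g (r i)) / real n)))
            + ennreal (exp (l * ((\<Sum>i\<in>{1..n}. - g (r i)) / real n))) \<partial>Pi\<^sub>M {1..n} (\<lambda>_. M))"
  proof (rule nn_integral_mono)
    fix r :: "nat \<Rightarrow> real"
    show "ennreal (exp (l * \<bar>cdf M x - ecdf r n x\<bar>))
        \<le> ennreal (exp (l * ((\<Sum>i\<in>{1..n}. g (r i)) / real n)))
            + ennreal (exp (l * ((\<Sum>i\<in>{1..n}. - g (r i)) / real n)))"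
      unfolding sum_negf minus_divide_left[symmetric] sum
      by (auto simp: abs_if ennreal_plus[symmetric] simp del: ennreal_plus intro!: ennreal_leI)
  qed
  also have "\<dots> = (\<integral>\<^sup>+r. ennreal (exp (l * ((\<Sum>i\<in>{1..n}. g (r i)) / real n))) \<partial>Pi\<^sub>M {1..n} (\<lambda>_. M))
      + (\<integral>\<^sup>+r. ennreal (exp (l * ((\<Sum>i\<in>{1..n}. - g (r i)) / real n))) \<partial>Pi\<^sub>M {1..n} (\<lambda>_. M))"
    by (intro nn_integral_add) measurable
  also have "\<dots> \<le> ennreal (exp (l\<^sup>2 * ((1 - cdf M x) - (- cdf M x))\<^sup>2 / (8 * real n)))
      + ennreal (exp (l\<^sup>2 * (cdf M x - (cdf M x - 1))\<^sup>2 / (8 * real n)))"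
    using mean assms range by (intro add_mono nn_integral_exp_mean_le) auto
  also have "\<dots> = ennreal (2 * exp (l\<^sup>2 / (8 * real n)))"
    by (simp add: ennreal_plus[symmetric] del: ennreal_plus)
  finally show ?thesis .
qed

section \<open>Concentration of the deviation averaged over the range\<close>

context bounded_distribution
begin

abbreviation sample :: "nat \<Rightarrow> (nat \<Rightarrow> real) measure" where
  "sample n \<equiv> Pi\<^sub>M {1..n} (\<lambda>_. D)"

lemma prob_space_sample: "prob_space (sample n)"
  by (intro prob_space_PiM D.prob_space_axioms)

text \<open>For \<open>n \<ge> 1\<close> and a sample in \<open>{0..R}\<close>, \<open>R\<close>
  times this is the Wasserstein-1 distance between \<open>D\<close> and the empirical
  distribution.\<close>

definition cdf_deviation :: "nat \<Rightarrow> (nat \<Rightarrow> real) \<Rightarrow> real" where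
  "cdf_deviation n r = (\<integral>x. \<bar>cdf D x - ecdf r n x\<bar> \<partial>U)"

lemma ecdf_measurable_pair: "(\<lambda>(r, x). ecdf r n x) \<in> borel_measurable (sample n \<Otimes>\<^sub>M U)"
proof -
  have "(\<lambda>p. if fst p i \<le> snd p then 1 else 0 :: real) \<in> borel_measurable (sample n \<Otimes>\<^sub>M U)"
    if [measurable]: "i \<in> {1..n}" for i by measurable
  then show ?thesis
    unfolding ecdf_def case_prod_beta of_bool_def
    by (intro borel_measurable_divide borel_measurable_sum borel_measurable_const) auto
qed

lemma ecdf_measurable:
  "(\<lambda>r. ecdf r n x) \<in> borel_measurable (sample n)" "ecdf r n \<in> borel_measurable borel"
  unfolding ecdf_def by measurable

lemma cdf_deviation_measurable [measurable]: "cdf_deviation n \<in> borel_measurable (sample n)"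
proof -
  note [measurable] = ecdf_measurable_pair
  show ?thesis unfolding cdf_deviation_def by measurable
qed

lemma abs_cdf_diff_ecdf_le: "\<bar>cdf D x - ecdf r n x\<bar> \<le> 1"
  using D.cdf_nonneg[of x] D.cdf_bounded_prob[of x] ecdf_nonneg[of r n x] ecdf_le_1[of r n x]
  by linarith

lemma integrable_cdf_diff_ecdf: "integrable U (\<lambda>x. \<bar>cdf D x - ecdf r n x\<bar>)"
proof (rule integrable_U_bounded[of _ 1])
  note [measurable] = ecdf_measurable(2)
  show "(\<lambda>x. \<bar>cdf D x - ecdf r n x\<bar>) \<in> borel_measurable borel" by measurable
qed (use abs_cdf_diff_ecdf_le in auto)

lemma nn_integral_exp_cdf_deviation_le:
  assumes "0 < l" "1 \<le> n"
  shows "(\<integral>\<^sup>+r. ennreal (exp (l * cdf_deviation n r)) \<partial>sample n)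
           \<le> ennreal (2 * exp (l\<^sup>2 / (8 * real n)))"
proof -
  interpret S: prob_space "sample n" by (rule prob_space_sample)
  interpret SU: pair_sigma_finite "sample n" U ..
  note [measurable] = ecdf_measurable_pair ecdf_measurable
  define e where "e = (\<lambda>r x. exp (l * \<bar>cdf D x - ecdf r n x\<bar>))"
  have e: "integrable U (e r)" for r
  proof (rule integrable_U_bounded[of _ "exp l"])
    show "e r \<in> borel_measurable borel" unfolding e_def by measurable
    show "\<bar>e r x\<bar> \<le> exp l" for x
      using abs_cdf_diff_ecdf_le[of x r n] assms by (simp add: e_def)
  qed
  have "(\<integral>\<^sup>+r. ennreal (exp (l * cdf_deviation n r)) \<partial>sample n)
      \<le> (\<integral>\<^sup>+r. (\<integral>\<^sup>+x. ennreal (e r x) \<partial>U) \<partial>sample n)"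
  proof (rule nn_integral_mono)
    fix r
    have "exp (l * cdf_deviation n r) \<le> (\<integral>x. e r x \<partial>U)"
      unfolding cdf_deviation_def e_def
    proof (rule U.jensens_inequality[where q = "\<lambda>x. exp (l * x)" and I = UNIV])
      show "integrable U (\<lambda>x. exp (l * \<bar>cdf D x - ecdf r n x\<bar>))"
        using e[of r] unfolding e_def .
    qed (use assms in \<open>auto intro: convex_on_exp integrable_cdf_diff_ecdf\<close>)
    then show "ennreal (exp (l * cdf_deviation n r)) \<le> (\<integral>\<^sup>+x. ennreal (e r x) \<partial>U)"
      using e by (subst nn_integral_eq_integral) (auto simp: e_def intro!: ennreal_leI)
  qed
  also have "\<dots> = (\<integral>\<^sup>+x. (\<integral>\<^sup>+r. ennreal (e r x) \<partial>sample n) \<partial>U)"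
    by (rule SU.Fubini'[symmetric]) (unfold e_def, measurable)
  \<comment> \<open>The pointwise bound is free of \<open>x\<close>, so averaging over
    \<open>U\<close> leaves it unchanged.\<close>
  also have "\<dots> \<le> (\<integral>\<^sup>+x. ennreal (2 * exp (l\<^sup>2 / (8 * real n))) \<partial>U)"
    unfolding e_def by (intro nn_integral_mono D.nn_integral_exp_abs_cdf_diff_ecdf_le assms)
  also have "\<dots> = ennreal (2 * exp (l\<^sup>2 / (8 * real n)))"
    using U.emeasure_space_1 by simp
  finally show ?thesis .
qed

lemma prob_cdf_deviation_le:
  assumes "1 \<le> n" "0 < \<delta>" "\<delta> < 1"
  shows "\<P>(r in sample n. cdf_deviation n r \<le> sqrt (ln (2 / \<delta>) / (2 * real n))) \<ge> 1 - \<delta>"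
proof -
  interpret S: prob_space "sample n" by (rule prob_space_sample)
  \<comment> \<open>Solves \<open>2 * exp (- 2 * n * \<epsilon>^2) = \<delta>\<close>, the two-sided
    Hoeffding tail.\<close>
  define \<epsilon> where "\<epsilon> = sqrt (ln (2 / \<delta>) / (2 * real n))"
  \<comment> \<open>The minimizer of the Chernoff exponent
    \<open>l^2 / (8 * n) - l * \<epsilon>\<close>.\<close>
  define l where "l = 4 * real n * \<epsilon>"
  have ln: "0 < ln (2 / \<delta>)" using assms by simp
  then have \<epsilon>: "0 < \<epsilon>" "\<epsilon>\<^sup>2 = ln (2 / \<delta>) / (2 * real n)"
    unfolding \<epsilon>_def using assms by simp_all
  then have l: "0 < l" using assms by (simp add: l_def)
  have "exp (- (l * \<epsilon>)) * (2 * exp (l\<^sup>2 / (8 * real n))) = 2 * exp (l\<^sup>2 / (8 * real n) - l * \<epsilon>)"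
    by (simp add: exp_diff exp_minus field_simps)
  also have "l\<^sup>2 / (8 * real n) - l * \<epsilon> = - (2 * real n * \<epsilon>\<^sup>2)"
    using assms by (simp add: l_def power2_eq_square field_simps)
  also have "\<dots> = - ln (2 / \<delta>)" using assms \<epsilon> by simp
  also have "2 * exp (- ln (2 / \<delta>)) = \<delta>" using assms by (simp add: exp_minus)
  finally have exp: "exp (- (l * \<epsilon>)) * (2 * exp (l\<^sup>2 / (8 * real n))) = \<delta>" .
  have "{r \<in> space (sample n). \<not> cdf_deviation n r \<le> \<epsilon>}
      \<subseteq> {r \<in> space (sample n). 1 \<le> ennreal (exp (- (l * \<epsilon>))) * ennreal (exp (l * cdf_deviation n r))}"
    using l by (auto simp: ennreal_mult[symmetric] exp_add[symmetric] simp flip: ennreal_1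
        intro!: ennreal_leI)
  then have "emeasure (sample n) {r \<in> space (sample n). \<not> cdf_deviation n r \<le> \<epsilon>}
      \<le> emeasure (sample n)
          {r \<in> space (sample n). 1 \<le> ennreal (exp (- (l * \<epsilon>))) * ennreal (exp (l * cdf_deviation n r))}"
    by (intro emeasure_mono) measurable
  also have "\<dots> \<le> ennreal (exp (- (l * \<epsilon>)))
      * (\<integral>\<^sup>+r. ennreal (exp (l * cdf_deviation n r)) * indicator (space (sample n)) r \<partial>sample n)"
    by (intro nn_integral_Markov_inequality) measurable
  also have "(\<integral>\<^sup>+r. ennreal (exp (l * cdf_deviation n r)) * indicator (space (sample n)) r \<partial>sample n)
      = (\<integral>\<^sup>+r. ennreal (exp (l * cdf_deviation n r)) \<partial>sample n)"
    by (intro nn_integral_cong) auto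
  also have "ennreal (exp (- (l * \<epsilon>))) * \<dots>
      \<le> ennreal (exp (- (l * \<epsilon>))) * ennreal (2 * exp (l\<^sup>2 / (8 * real n)))"
    by (intro mult_left_mono nn_integral_exp_cdf_deviation_le l assms) auto
  also have "\<dots> = ennreal \<delta>" using exp by (simp add: ennreal_mult[symmetric])
  finally have "\<P>(r in sample n. \<not> cdf_deviation n r \<le> \<epsilon>) \<le> \<delta>"
    using assms by (subst (asm) S.emeasure_eq_measure) simp
  moreover have "\<P>(r in sample n. \<not> cdf_deviation n r \<le> \<epsilon>)
      = 1 - \<P>(r in sample n. cdf_deviation n r \<le> \<epsilon>)"
    by (rule S.prob_neg) measurable
  ultimately show ?thesis
    unfolding \<epsilon>_def by linarith
qed

end

section \<open>The belief\<close>

lemma sets_mixture [simp]: "sets (mixture c P Q) = sets borel"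
  unfolding mixture_def
  by (metis sets.sigma_sets_eq sets_measure_of space_borel subset_UNIV Pow_UNIV top_greatest)

text \<open>Only an inclusion relates \<open>sets Q\<close> to the Borel sets, because every set is
  measurable for the \<open>pmf\<close> of the empirical distribution.\<close>

lemma
  assumes "real_distribution P" "prob_space Q" "sets borel \<subseteq> sets Q" "space Q = UNIV"
    and c: "0 \<le> c" "c \<le> 1"
  shows real_distribution_mixture: "real_distribution (mixture c P Q)"
    and cdf_mixture: "cdf (mixture c P Q) x = c * cdf P x + (1 - c) * cdf Q x"
proof -
  interpret P: real_distribution P by fact
  interpret Q: prob_space Q by fact
  have *: "emeasure (mixture c P Q) A = ennreal (c * measure P A + (1 - c) * measure Q A)"
    if "A \<in> sets borel" for A
    using that c emeasure_mixture[OF P.events_eq_borel assms(3) that]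
    by (simp add: P.emeasure_eq_measure Q.emeasure_eq_measure ennreal_mult)
  have space: "space (mixture c P Q) = UNIV"
    using sets_eq_imp_space_eq[OF sets_mixture] by simp
  have "prob_space (mixture c P Q)"
    using *[of UNIV] P.prob_space Q.prob_space assms(4)
    by (intro prob_spaceI) (simp add: space)
  then show "real_distribution (mixture c P Q)"
    by (simp add: real_distribution_def real_distribution_axioms_def)
  show "cdf (mixture c P Q) x = c * cdf P x + (1 - c) * cdf Q x"
    using *[of "{..x}"] c
    by (simp add: cdf_def measure_def[of "mixture c P Q"] del: ennreal_plus)
qed

lemma
  assumes "positive_density_prior R P"
  shows positive_density_prior_real_distribution: "real_distribution P"
    and positive_density_prior_cdf: "cdf P R = 1"
proof -
  obtain f :: "real \<Rightarrow> real" where [measurable]: "f \<in> borel_measurable borel"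
    and P: "prob_space P" "P = density lborel (\<lambda>x. ennreal (f x) * indicator {0..R} x)"
    using assms by (auto simp: positive_density_prior_def)
  interpret prob_space P by fact
  show rd: "real_distribution P"
    using P by (simp add: real_distribution_def real_distribution_axioms_def)
  have "AE x in P. x \<in> {..R}"
    by (subst P(2), subst AE_density) (auto simp: indicator_def)
  then show "cdf P R = 1"
    unfolding cdf_def using P(2) by (subst prob_eq_1) (simp_all add: P(2))
qed

section \<open>Measurability and probability of the event that all levels are good\<close>

context bounded_distribution
begin

text \<open>Replaces the minimum by each fixed competitor \<open>s\<close>. Nonnegativity of the
  loss supplies the lower bound that a real \<open>INF\<close> requires.\<close>

lemma le_INF_expected_loss_iff:
  assumes "\<alpha> \<in> {0..1}"
  shows "c \<le> (INF s\<in>{0..R}. expected_loss D \<alpha> s) + B \<longleftrightarrow> (\<forall>s\<in>{0..R}. c \<le> expected_loss D \<alpha> s + B)"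
proof -
  have "bdd_below (expected_loss D \<alpha> ` {0..R})"
    using expected_loss_nonneg[OF assms] by (auto intro!: bdd_belowI[of _ 0])
  then have "c - B \<le> (INF s\<in>{0..R}. expected_loss D \<alpha> s) \<longleftrightarrow> (\<forall>s\<in>{0..R}. c - B \<le> expected_loss D \<alpha> s)"
    using pos by (intro le_cINF_iff) auto
  then show ?thesis by (simp add: algebra_simps)
qed

text \<open>This makes the uncountable intersection over \<open>\<alpha>\<close> measurable. At irrational \<open>\<alpha>\<close> it uses that
  \<open>\<alpha> \<mapsto> quantile R K \<alpha>\<close> is left continuous, which holds even where the \<open>LEAST\<close> is over an empty set,
  since all those levels get the same junk value.\<close>

lemma excess_loss_le_if_rational_levels:
  assumes "real_distribution K"
    and rat: "\<And>\<beta> s. \<beta> \<in> \<rat> \<Longrightarrow> \<beta> \<in> {0..1} \<Longrightarrow> s \<in> {0..R} \<Longrightarrow>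
          expected_loss D \<beta> (quantile R K \<beta>) \<le> expected_loss D \<beta> s + B"
    and "\<alpha> \<in> {0..1}" "s \<in> {0..R}"
  shows "expected_loss D \<alpha> (quantile R K \<alpha>) \<le> expected_loss D \<alpha> s + B"
\<comment> \<open>Approaching 0 from the left would leave \<open>{0..1}\<close>, but 0 is itself
  rational.\<close>
proof (cases "\<alpha> = 0")
  case True
  then show ?thesis using rat[of 0] assms by simp
next
  case False
  interpret K: real_distribution K by fact
  \<comment> \<open>With \<open>s\<close> fixed, \<open>h\<close> is left continuous at
    \<open>\<alpha>\<close>, because the quantile is and \<open>upper_mean\<close> is
    continuous.\<close>
  define h where "h \<beta> = expected_loss D \<beta> (quantile R K \<beta>) - expected_loss D \<beta> s" for \<beta>
  have q: "((\<lambda>\<beta>. quantile R K \<beta>) \<longlongrightarrow> quantile R K \<alpha>) (at_left \<alpha>)"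
    using pos by (intro K.tendsto_quantile_at_left) simp
  have "isCont upper_mean x" for x
    using continuous_upper_mean by (simp add: continuous_on_eq_continuous_at)
  from isCont_tendsto_compose[OF this q]
  have "(h \<longlongrightarrow> h \<alpha>) (at_left \<alpha>)"
    unfolding h_def expected_loss_eq by (intro tendsto_intros q)
  have "h \<alpha> \<le> B"
  proof (rule ccontr)
    assume "\<not> h \<alpha> \<le> B"
    with \<open>(h \<longlongrightarrow> h \<alpha>) (at_left \<alpha>)\<close> have "eventually (\<lambda>\<beta>. B < h \<beta>) (at_left \<alpha>)"
      by (intro order_tendstoD) auto
    then obtain b where b: "b < \<alpha>" "\<And>\<beta>. b < \<beta> \<Longrightarrow> \<beta> < \<alpha> \<Longrightarrow> B < h \<beta>"
      by (auto simp: eventually_at_left[of "\<alpha> - 1"])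
    have "max b 0 < \<alpha>" using b False assms by auto
    then obtain \<beta> where "\<beta> \<in> \<rat>" "max b 0 < \<beta>" "\<beta> < \<alpha>"
      using Rats_dense_in_real by blast
    with b rat[of \<beta> s] assms show False by (force simp: h_def)
  qed
  then show ?thesis by (simp add: h_def)
qed

text \<open>Non-measurable sets have \<open>measure\<close> 0 by convention, so a lower bound on the
  probability of this event requires it to be measurable.\<close>

lemma sets_excess_loss_le:
  assumes K: "\<And>r. real_distribution (K r)"
    and meas: "\<And>x. (\<lambda>r. cdf (K r) x) \<in> borel_measurable N"
  shows "{r \<in> space N. \<forall>\<alpha>\<in>{0..1}. expected_loss D \<alpha> (quantile R (K r) \<alpha>)
            \<le> (INF s\<in>{0..R}. expected_loss D \<alpha> s) + B} \<in> sets N" (is "?E \<in> _")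
proof -
  have "?E = {r \<in> space N. \<forall>\<alpha>\<in>\<rat> \<inter> {0..1}. expected_loss D \<alpha> (quantile R (K r) \<alpha>)
            \<le> (INF s\<in>{0..R}. expected_loss D \<alpha> s) + B}"
    using excess_loss_le_if_rational_levels[OF K, of _ B]
    by (auto simp: le_INF_expected_loss_iff)
  also have "\<dots> \<in> sets N"
  proof (rule sets.sets_Collect_countable_All')
    fix \<alpha> :: real
    have [measurable]: "(\<lambda>r. quantile R (K r) \<alpha>) \<in> borel_measurable N"
      using pos by (intro borel_measurable_quantile K meas) simp
    have [measurable]: "upper_mean \<in> borel_measurable borel"
      by (intro borel_measurable_continuous_onI continuous_upper_mean)
    show "{r \<in> space N. expected_loss D \<alpha> (quantile R (K r) \<alpha>)
            \<le> (INF s\<in>{0..R}. expected_loss D \<alpha> s) + B} \<in> sets N"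
      unfolding expected_loss_eq by measurable
  qed (simp add: countable_rat)
  finally show ?thesis .
qed

text \<open>In the averaged deviation the prior costs at most \<open>lam t\<close> and sampling at
  most the concentration radius. Leaving \<open>B\<close> free reduces the final theorem to
  arithmetic.\<close>

lemma prob_forecast_excess_le:
  assumes P0: "positive_density_prior R P0" and t: "2 \<le> t" and lam: "0 \<le> lam t" "lam t \<le> 1"
    and \<delta>: "0 < \<delta>" "\<delta> < 1"
    and B: "R * (lam t + sqrt (ln (2 / \<delta>) / (2 * real (t - 1)))) \<le> B"
  shows "\<P>(r in sample (t - 1). \<forall>\<alpha>\<in>{0..1}. expected_loss D \<alpha> (forecast R P0 lam r t \<alpha>)
            \<le> (INF s\<in>{0..R}. expected_loss D \<alpha> s) + B) \<ge> 1 - \<delta>"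
proof -
  \<comment> \<open>The belief at time \<open>t\<close> has seen only the \<open>t - 1\<close>
    earlier scores.\<close>
  define n where "n = t - 1"
  define \<epsilon> where "\<epsilon> = sqrt (ln (2 / \<delta>) / (2 * real n))"
  have n: "1 \<le> n" using t by (simp add: n_def)
  interpret S: prob_space "sample n" by (rule prob_space_sample)
  interpret P: real_distribution P0
    by (rule positive_density_prior_real_distribution[OF P0])
  define K where "K r = belief P0 lam r t" for r
  note mixture_prems = P.real_distribution_axioms measure_pmf.prob_space_axioms
  have K: "real_distribution (K r)" for r
    unfolding K_def belief_def by (intro real_distribution_mixture mixture_prems lam) auto
  have cdf_K: "cdf (K r) x = lam t * cdf P0 x + (1 - lam t) * ecdf r n x" for r x
    using lam n by (simp add: K_def belief_def n_def cdf_mixture[OF mixture_prems] cdf_empirical)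
  note [measurable] = ecdf_measurable
  have meas: "(\<lambda>r. cdf (K r) x) \<in> borel_measurable (sample n)" for x
    unfolding cdf_K by measurable
  have good: "expected_loss D \<alpha> (quantile R (K r) \<alpha>) \<le> (INF s\<in>{0..R}. expected_loss D \<alpha> s) + B"
    if r: "\<forall>i\<in>{1..n}. r i \<in> {0..R}" "cdf_deviation n r \<le> \<epsilon>" and \<alpha>: "\<alpha> \<in> {0..1}" for r \<alpha>
    unfolding le_INF_expected_loss_iff[OF \<alpha>]
  proof
    fix s assume s: "s \<in> {0..R}"
    \<comment> \<open>With the prior also carried by \<open>{0..R}\<close>, this gives
      \<open>cdf (K r) R = 1\<close>, so every level up to 1 has a genuine quantile.\<close>
    have "ecdf r n R = 1" using r n by (simp add: ecdf_def)
    then have "\<alpha> \<le> cdf (K r) R"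
      using \<alpha> by (simp add: cdf_K positive_density_prior_cdf[OF P0])
    note excess_loss_le[OF K this s]
    also have "(\<integral>x. \<bar>cdf D x - cdf (K r) x\<bar> \<partial>U) \<le> (\<integral>x. lam t + \<bar>cdf D x - ecdf r n x\<bar> \<partial>U)"
    proof (rule Bochner_Integration.integral_mono)
      have [measurable]: "cdf P0 \<in> borel_measurable borel"
        by (rule borel_measurable_mono) (auto intro!: monoI P.cdf_nondecreasing)
      have le: "\<bar>cdf D x - cdf (K r) x\<bar> \<le> lam t + \<bar>cdf D x - ecdf r n x\<bar>" for x
      proof -
        \<comment> \<open>Mixing in the prior moves the empirical distribution function by at most
          the weight \<open>lam t\<close>.\<close>
        have "cdf D x - cdf (K r) x
            = (cdf D x - ecdf r n x) + lam t * (ecdf r n x - cdf P0 x)"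
          by (simp add: cdf_K algebra_simps)
        moreover have "\<bar>ecdf r n x - cdf P0 x\<bar> \<le> 1"
          using P.cdf_nonneg[of x] P.cdf_bounded_prob[of x] ecdf_nonneg[of r n x] ecdf_le_1[of r n x]
          by linarith
        then have "\<bar>lam t * (ecdf r n x - cdf P0 x)\<bar> \<le> lam t"
          using lam by (simp add: abs_mult mult_left_le)
        ultimately show ?thesis by linarith
      qed
      then show "\<bar>cdf D x - cdf (K r) x\<bar> \<le> lam t + \<bar>cdf D x - ecdf r n x\<bar>" for x .
      show int: "integrable U (\<lambda>x. lam t + \<bar>cdf D x - ecdf r n x\<bar>)"
        by (intro Bochner_Integration.integrable_add integrable_cdf_diff_ecdf) simp
      show "integrable U (\<lambda>x. \<bar>cdf D x - cdf (K r) x\<bar>)"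
      proof (rule integrable_U_bounded[of _ "lam t + 1"])
        show "(\<lambda>x. \<bar>cdf D x - cdf (K r) x\<bar>) \<in> borel_measurable borel"
          unfolding cdf_K by measurable
        show "\<bar>\<bar>cdf D x - cdf (K r) x\<bar>\<bar> \<le> lam t + 1" for x
          using le[of x] abs_cdf_diff_ecdf_le[of x r n] by linarith
      qed
    qed
    also have "(\<integral>x. lam t + \<bar>cdf D x - ecdf r n x\<bar> \<partial>U) = lam t + cdf_deviation n r"
      unfolding cdf_deviation_def using U.prob_space
      by (subst Bochner_Integration.integral_add) (auto intro: integrable_cdf_diff_ecdf)
    also have "R * (lam t + cdf_deviation n r) \<le> B"
    proof (rule order_trans[OF _ B], intro mult_left_mono add_left_mono)
      show "cdf_deviation n r \<le> sqrt (ln (2 / \<delta>) / (2 * real (t - 1)))"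
        using r by (simp add: \<epsilon>_def n_def)
    qed (use pos in simp)
    finally show "expected_loss D \<alpha> (quantile R (K r) \<alpha>) \<le> expected_loss D \<alpha> s + B"
      using pos by simp
  qed
  \<comment> \<open>Scores lie in the range only almost surely, so the two events are compared up to
    a null set.\<close>
  have AE: "AE r in sample n. \<forall>i\<in>{1..n}. r i \<in> {0..R}"
    by (intro eventually_ball_finite ballI AE_PiM_component D.prob_space_axioms AE_in) auto
  have "1 - \<delta> \<le> \<P>(r in sample n. cdf_deviation n r \<le> \<epsilon>)"
    unfolding \<epsilon>_def by (rule prob_cdf_deviation_le[OF n \<delta>])
  also have "\<dots> \<le> \<P>(r in sample n. \<forall>\<alpha>\<in>{0..1}. expected_loss D \<alpha> (quantile R (K r) \<alpha>)
            \<le> (INF s\<in>{0..R}. expected_loss D \<alpha> s) + B)"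
  proof (rule S.finite_measure_mono_AE)
    show "AE r in sample n. r \<in> {r \<in> space (sample n). cdf_deviation n r \<le> \<epsilon>} \<longrightarrow>
        r \<in> {r \<in> space (sample n). \<forall>\<alpha>\<in>{0..1}. expected_loss D \<alpha> (quantile R (K r) \<alpha>)
            \<le> (INF s\<in>{0..R}. expected_loss D \<alpha> s) + B}"
      using AE by eventually_elim (use good in blast)
  qed (intro sets_excess_loss_le K meas)
  finally show ?thesis by (simp add: forecast_def K_def n_def)
qed

end

text \<open>The constant of the rate is chosen before \<open>R\<close>, \<open>D\<close>,
  \<open>P0\<close>, \<open>t\<close> and \<open>\<delta>\<close>. Keeping \<open>\<delta>\<close>
  at most \<open>\<eta>\<close> bounds \<open>ln (1 / \<delta>)\<close> away from 0, so that up to a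
  constant it dominates both the 1 of the prior term and the \<open>ln (2 / \<delta>)\<close> of the
  concentration bound.\<close>

theorem theorem4:
  fixes \<eta> :: real
  assumes "0 < \<eta>" and "\<eta> < 1"
  shows "\<exists>C>0. \<forall>(R::real) (D::real measure) (P0::real measure) (t::nat) (\<delta>::real).
    R > 0 \<longrightarrow> distribution_on R D \<longrightarrow> positive_density_prior R P0 \<longrightarrow>
    t \<ge> 2 \<longrightarrow> 0 < \<delta> \<longrightarrow> \<delta> \<le> \<eta> \<longrightarrow>
    \<P>(r in Pi\<^sub>M {1..t - 1} (\<lambda>_. D).
        \<forall>\<alpha>\<in>{0..1}.
          expected_loss D \<alpha> (forecast R P0 (\<lambda>k. 1 / sqrt (real k)) r t \<alpha>)
            \<le> (INF s\<in>{0..R}. expected_loss D \<alpha> s) + C * (R * sqrt (ln (1 / \<delta>) / real t)))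
      \<ge> 1 - \<delta>"
proof -
  define c where "c = ln (1 / \<eta>)"
  \<comment> \<open>The first summand absorbs the step size \<open>1 / sqrt t\<close>, the second
    the sampling error; both use \<open>c \<le> ln (1 / \<delta>)\<close>.\<close>
  define C where "C = 1 / sqrt c + sqrt (1 + ln 2 / c)"
  have c: "0 < c" using assms by (simp add: c_def)
  show ?thesis
  proof (intro exI[of _ C] conjI allI impI)
    show "0 < C" using c by (simp add: C_def add_pos_nonneg)
  next
    fix R :: real and D P0 :: "real measure" and t :: nat and \<delta> :: real
    assume "R > 0" "distribution_on R D" and P0: "positive_density_prior R P0"
      and t: "t \<ge> 2" and \<delta>: "0 < \<delta>" "\<delta> \<le> \<eta>"
    then interpret bounded_distribution R D by unfold_locales
    define L where "L = ln (1 / \<delta>)"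
    have L: "c \<le> L" using \<delta> assms by (simp add: c_def L_def frac_le)
    have "1 / sqrt t = 1 / sqrt c * sqrt (c / t)"
      using c by (simp add: real_sqrt_divide)
    also have "\<dots> \<le> 1 / sqrt c * sqrt (L / t)"
      using L c by (intro mult_left_mono real_sqrt_le_mono divide_right_mono) auto
    finally have 1: "1 / sqrt t \<le> 1 / sqrt c * sqrt (L / t)" .
    have "ln (2 / \<delta>) = ln 2 + L"
      using \<delta> by (simp add: L_def ln_div)
    also have "ln 2 = ln 2 / c * c" using c by simp
    also have "\<dots> \<le> ln 2 / c * L" using L c by (intro mult_left_mono) auto
    finally have "ln (2 / \<delta>) \<le> (1 + ln 2 / c) * L" by (simp add: algebra_simps)
    \<comment> \<open>For \<open>t \<ge> 2\<close>, \<open>2 * (t - 1) \<ge> t\<close>: the 2 of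
      Hoeffding's bound pays for the missing sample.\<close>
    then have "ln (2 / \<delta>) / (2 * real (t - 1)) \<le> (1 + ln 2 / c) * L / real t"
      using t L c by (intro frac_le) auto
    then have 2: "sqrt (ln (2 / \<delta>) / (2 * real (t - 1))) \<le> sqrt (1 + ln 2 / c) * sqrt (L / t)"
      by (simp add: real_sqrt_mult[symmetric])
    have "R * (1 / sqrt t + sqrt (ln (2 / \<delta>) / (2 * real (t - 1)))) \<le> R * (C * sqrt (L / t))"
      using 1 2 pos unfolding C_def by (intro mult_left_mono) (auto simp: distrib_right)
    then show "\<P>(r in Pi\<^sub>M {1..t - 1} (\<lambda>_. D).
        \<forall>\<alpha>\<in>{0..1}.
          expected_loss D \<alpha> (forecast R P0 (\<lambda>k. 1 / sqrt (real k)) r t \<alpha>)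
            \<le> (INF s\<in>{0..R}. expected_loss D \<alpha> s) + C * (R * sqrt (ln (1 / \<delta>) / real t)))
      \<ge> 1 - \<delta>"
      using t \<delta> assms by (intro prob_forecast_excess_le P0) (auto simp: L_def algebra_simps)
  qed
qed

end
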